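(* Assume that $G_0\subset\mathbb{R}^n$ is a starry compact set. The trivial solution $x(t)\equiv 0$ of the system $\frac{dx}{dt}=f(x,t)$ is $\{G_0,\Phi_t,t_0,T\}$-stable if and only if there exists a continuous function $W:\mathbb{R}^n\times[t_0,T]\times\mathbb{R}^n\to\mathbb{R}$, $(x,t,x_0)\mapsto W(x,t,x_0)$, such that the derivative of $W$ along the system satisfies $\left(\frac{dW}{dt}\right)\le 0$ (that is, for every fixed $x_0$ and every solution $x(\cdot)$ of the system, the function $t\mapsto W(x(t),t,x_0)$ is differentiable on $[t_0,T]$ with nonpositive derivative), and $$\{(x,x_0): W(x,t,x_0)\le 1\}\subseteq\{(x,x_0): x\in\Phi_t,\ x_0\in G_0\}\quad\text{for all } t\in[t_0,T],$$ $$G_0\subseteq\{x_0: W(x_0,t_0,x_0)\le 1\}.$$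
   Context: Let $n\ge 1$ and $t_0<T$. Consider the system of ordinary differential equations $\frac{dx}{dt}=f(x,t)$, $x\in\mathbb{R}^n$, $t\in[t_0,T]$, where $f:\mathbb{R}^n\times[t_0,T]\to\mathbb{R}^n$ satisfies the conditions of the existence and uniqueness theorem: $f$ is continuous, locally Lipschitz in $x$, and for every $s\in[t_0,T]$ and $\xi\in\mathbb{R}^n$ there is a unique solution with $x(s)=\xi$, defined on all of $[t_0,T]$. Moreover $f(0,t)=0$ for all $t\in[t_0,T]$. Denote by $x(t,x_0,t_0)$ the solution with $x(t_0)=x_0$. For each $t\in[t_0,T]$ let $\Phi_t\subset\mathbb{R}^n$ be a compact set with $0\in\Phi_t$ (no regularity in $t$ is assumed). Let $G_0\subseteq\Phi_{t_0}$ with $0\in G_0$. Definition (stability). The solution $x(t)\equiv 0$ is said to be $\{G_0,\Phi_t,t_0,T\}$-stable if $x(t,x_0,t_0)\in\Phi_t$ for all $t\in[t_0,T]$ whenever $x_0\in G_0$. Definition (starry set). For $x\in\mathbb{R}^n\setminus\{0\}$ put $L_x=\{\lambda x:\lambda\ge 0\}$. A set $E\subseteq\mathbb{R}^n$ is starry if it is closed, $0\in\operatorname{int}E$, and for every $x\in\mathbb{R}^n\setminus\{0\}$ either $L_x\subset E$ or there exists a unique point $z\in L_x$ with $z\in\partial E$. *)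

theory Defs
  imports "HOL-Analysis.Analysis"
begin

text \<open>The ODE \<open>dx/dt = f(x,t)\<close> on \<open>[t0,T]\<close>: the right-hand side is a curried total function, of which
  only the values for \<open>t \<in> [t0,T]\<close> matter. Derivatives at the endpoints are one-sided.\<close>

definition solves_on ::
  "(real^'n \<Rightarrow> real \<Rightarrow> real^'n) \<Rightarrow> real \<Rightarrow> real \<Rightarrow> (real \<Rightarrow> real^'n) \<Rightarrow> bool" where
  "solves_on f t0 T x \<longleftrightarrow>
     (\<forall>t\<in>{t0..T}. (x has_vector_derivative f (x t) t) (at t within {t0..T}))"

text \<open>Uniqueness can only concern the values on \<open>[t0,T]\<close>, as solutions are represented by total functions.\<close>

definition uniquely_solvable ::
  "(real^'n \<Rightarrow> real \<Rightarrow> real^'n) \<Rightarrow> real \<Rightarrow> real \<Rightarrow> bool" where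
  "uniquely_solvable f t0 T \<longleftrightarrow>
     (\<forall>s\<in>{t0..T}. \<forall>\<xi>. \<exists>x. solves_on f t0 T x \<and> x s = \<xi> \<and>
        (\<forall>y. solves_on f t0 T y \<and> y s = \<xi> \<longrightarrow> (\<forall>t\<in>{t0..T}. y t = x t)))"

text \<open>\<open>x(t,x0,t0)\<close>: the value at \<open>t \<in> [t0,T]\<close> of the solution starting in \<open>x0\<close> at time \<open>t0\<close>;
  well defined if the system is uniquely solvable.\<close>

definition ode_solution ::
  "(real^'n \<Rightarrow> real \<Rightarrow> real^'n) \<Rightarrow> real \<Rightarrow> real \<Rightarrow> real \<Rightarrow> real^'n \<Rightarrow> real^'n" where
  "ode_solution f t0 T t x0 = (THE v. \<exists>x. solves_on f t0 T x \<and> x t0 = x0 \<and> x t = v)"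

definition zero_stable ::
  "(real^'n \<Rightarrow> real \<Rightarrow> real^'n) \<Rightarrow> (real^'n) set \<Rightarrow> (real \<Rightarrow> (real^'n) set) \<Rightarrow> real \<Rightarrow> real \<Rightarrow> bool" where
  "zero_stable f G0 \<Phi> t0 T \<longleftrightarrow>
     (\<forall>x0\<in>G0. \<forall>t\<in>{t0..T}. ode_solution f t0 T t x0 \<in> \<Phi> t)"

definition ray :: "real^'n \<Rightarrow> (real^'n) set" where
  "ray x = {c *\<^sub>R x | c. c \<ge> 0}"

definition starry :: "(real^'n) set \<Rightarrow> bool" where
  "starry E \<longleftrightarrow> closed E \<and> 0 \<in> interior E \<and>
     (\<forall>x. x \<noteq> 0 \<longrightarrow> ray x \<subseteq> E \<or> (\<exists>!z. z \<in> ray x \<and> z \<in> frontier E))"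

end

theory Submission
  imports Defs
begin

text \<open>Since the system can be solved backwards, the point \<open>\<pi>(x,t)\<close> at time \<open>t0\<close> of the solution
  through \<open>(x,t)\<close> is constant along every solution, and it depends continuously on \<open>(x,t)\<close> by a
  Gronwall estimate. Hence \<open>W(x,t,x0) = 1 + dist(\<pi>(x,t), G0) + dist(x0, G0)\<close> is continuous and
  constant along solutions, and \<open>W \<le> 1\<close> says exactly that \<open>x0 \<in> G0\<close> and that \<open>x\<close> is reached at time
  \<open>t\<close> from a point of \<open>G0\<close>. The converse is the usual Lyapunov monotonicity argument.\<close>

section \<open>Solutions and their uniqueness\<close>

lemma solves_on_continuous: "solves_on f t0 T x \<Longrightarrow> continuous_on {t0..T} x"
  unfolding solves_on_def by (rule continuous_on_vector_derivative) auto

lemma solves_on_unique: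
  assumes "uniquely_solvable f t0 T" "solves_on f t0 T x" "solves_on f t0 T y"
    and "s \<in> {t0..T}" "x s = y s" "t \<in> {t0..T}"
  shows "x t = y t"
  using assms unfolding uniquely_solvable_def by metis

lemma ode_solution_eq:
  assumes "uniquely_solvable f t0 T" "solves_on f t0 T x" "t \<in> {t0..T}"
  shows "ode_solution f t0 T t (x t0) = x t"
  unfolding ode_solution_def
proof (rule the_equality)
  show "\<exists>y. solves_on f t0 T y \<and> y t0 = x t0 \<and> y t = x t"
    using assms(2) by blast
  show "v = x t" if v: "\<exists>y. solves_on f t0 T y \<and> y t0 = x t0 \<and> y t = v" for v
  proof -
    obtain y where y: "solves_on f t0 T y" "y t0 = x t0" "y t = v"
      using v by blast
    have "t0 \<in> {t0..T}" using assms(3) by simp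
    then show ?thesis
      using solves_on_unique[OF assms(1) y(1) assms(2) _ y(2) assms(3)] y(3) by simp
  qed
qed

section \<open>Separation of two solutions backwards in time\<close>

text \<open>The Lipschitz bound lets the squared distance decay at rate at most
  \<open>2 * L\<close>, so weighting it by \<open>exp (2 * L * t)\<close> makes it nondecreasing.
  Squaring avoids differentiating the norm at 0. Membership in \<open>K\<close> is asked only
  strictly between \<open>a\<close> and \<open>s\<close>, so the estimate still applies at a time
  \<open>a\<close> where a solution may just have left \<open>K\<close>.\<close>

lemma gronwall_backward:
  assumes x: "solves_on f t0 T x" and y: "solves_on f t0 T y"
    and lip: "\<And>t. t \<in> {t0..T} \<Longrightarrow> L-lipschitz_on K (\<lambda>z. f z t)"
    and s: "s \<in> {t0..T}" and a: "a \<in> {t0..s}"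
    and K: "\<And>t. t \<in> {a<..<s} \<Longrightarrow> x t \<in> K \<and> y t \<in> K"
  shows "norm (y a - x a) \<le> norm (y s - x s) * exp (L * (s - a))"
proof -
  define u where "u t = y t - x t" for t
  define g where "g t = exp (2 * L * t) * (u t \<bullet> u t)" for t
  have "continuous_on {a..s} u"
    unfolding u_def using s a
    by (intro continuous_intros continuous_on_subset[OF solves_on_continuous[OF x]]
        continuous_on_subset[OF solves_on_continuous[OF y]]) auto
  then have cont: "continuous_on {a..s} g"
    unfolding g_def by (intro continuous_intros)
  have "g a \<le> g s"
  proof (rule DERIV_nonneg_imp_increasing_open[where f = g])
    show "a \<le> s" using a by simp
    show "continuous_on {a..s} g" by (fact cont)
    fix t assume t: "a < t" "t < s"
    then have t_in: "t \<in> {t0..T}" and "t \<in> {t0<..<T}"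
      using a s by auto
    define d where "d = f (y t) t - f (x t) t"
    \<comment> \<open>Only interior times occur here, so the derivatives within the interval are
      two-sided.\<close>
    have "at t within {t0..T} = at t"
      using \<open>t \<in> {t0<..<T}\<close> by (intro at_within_interior) auto
    then have "(x has_vector_derivative f (x t) t) (at t)" "(y has_vector_derivative f (y t) t) (at t)"
      using x y t_in unfolding solves_on_def by metis+
    then have u': "(u has_vector_derivative d) (at t)"
      unfolding u_def d_def by (intro derivative_intros)
    have uu': "((\<lambda>t. u t \<bullet> u t) has_real_derivative 2 * (u t \<bullet> d)) (at t)"
      using has_derivative_inner[OF u'[unfolded has_vector_derivative_def]
          u'[unfolded has_vector_derivative_def]]
      unfolding has_field_derivative_def
      by (rule has_derivative_eq_rhs) (auto simp: inner_commute algebra_simps)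
    have deriv: "(g has_real_derivative exp (2 * L * t) * (2 * (L * (u t \<bullet> u t) + u t \<bullet> d))) (at t)"
      unfolding g_def
      by (rule derivative_eq_intros uu' refl | simp add: algebra_simps)+
    \<comment> \<open>Cauchy-Schwarz and the Lipschitz bound give
      \<open>u t \<bullet> d \<ge> - L * (u t \<bullet> u t)\<close>.\<close>
    have "0 \<le> L * (u t \<bullet> u t) + u t \<bullet> d"
    proof -
      have "norm d \<le> L * norm (u t)"
        using lipschitz_onD[OF lip[OF t_in], of "y t" "x t"] K[of t] t
        by (auto simp: d_def u_def dist_norm)
      then have "norm (u t) * norm d \<le> norm (u t) * (L * norm (u t))"
        by (intro mult_left_mono) auto
      moreover have "\<bar>u t \<bullet> d\<bar> \<le> norm (u t) * norm d"
        by (rule Cauchy_Schwarz_ineq2)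
      ultimately show ?thesis
        by (simp add: dot_square_norm power2_eq_square algebra_simps)
    qed
    then have "0 \<le> exp (2 * L * t) * (2 * (L * (u t \<bullet> u t) + u t \<bullet> d))"
      by (intro mult_nonneg_nonneg) auto
    with deriv show "\<exists>D. (g has_real_derivative D) (at t) \<and> D \<ge> 0"
      by blast
  qed
  moreover have "g t = (exp (L * t) * norm (u t))\<^sup>2" for t
    by (simp add: g_def power_mult_distrib dot_square_norm mult.assoc flip: exp_double)
  ultimately have "(exp (L * a) * norm (u a))\<^sup>2 \<le> (exp (L * s) * norm (u s))\<^sup>2"
    by simp
  then have "exp (L * a) * norm (u a) \<le> exp (L * s) * norm (u s)"
    by (rule power2_le_imp_le) simp
  then have "norm (u a) \<le> norm (u s) * (exp (L * s) / exp (L * a))"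
    by (simp add: field_simps)
  then show ?thesis
    by (simp add: u_def right_diff_distrib exp_diff)
qed

text \<open>The constant \<open>L\<close> is valid only on a ball, so \<open>y\<close> must first be
  confined to it. A continuation argument does this: going back from \<open>s\<close>,
  \<open>y\<close> cannot leave the tube of radius 1 around \<open>x\<close>, because the Gronwall
  bound keeps the distance below 1.\<close>

lemma initial_value_estimate:
  assumes x: "solves_on f t0 T x" and y: "solves_on f t0 T y"
    and lip: "\<And>t. t \<in> {t0..T} \<Longrightarrow> L-lipschitz_on (cball 0 R) (\<lambda>z. f z t)"
    and R: "\<And>t. t \<in> {t0..T} \<Longrightarrow> norm (x t) + 1 \<le> R"
    and s: "s \<in> {t0..T}"
    and small: "norm (y s - x s) * exp (L * (T - t0)) < 1"
  shows "norm (y t0 - x t0) \<le> norm (y s - x s) * exp (L * (T - t0))"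
proof -
  have "0 \<le> L"
    using lip[OF s] by (rule lipschitz_on_nonneg)
  have est: "norm (y a - x a) \<le> norm (y s - x s) * exp (L * (T - t0))"
    if a: "a \<in> {t0..s}" and lt: "\<And>t. t \<in> {a<..<s} \<Longrightarrow> norm (y t - x t) < 1" for a
  proof -
    have "norm (y a - x a) \<le> norm (y s - x s) * exp (L * (s - a))"
    proof (rule gronwall_backward[OF x y lip s a])
      fix t assume t: "t \<in> {a<..<s}"
      then have "norm (x t) + 1 \<le> R" using a s by (intro R) auto
      moreover have "norm (y t) \<le> norm (x t) + norm (y t - x t)"
        by (rule norm_triangle_sub)
      ultimately show "x t \<in> cball 0 R \<and> y t \<in> cball 0 R"
        using lt[OF t] by auto
    qed
    also have "\<dots> \<le> norm (y s - x s) * exp (L * (T - t0))"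
      using a s \<open>0 \<le> L\<close> by (intro mult_left_mono) (auto intro!: mult_left_mono)
    finally show ?thesis .
  qed
  \<comment> \<open>The times at which \<open>y\<close> is outside the open tube. The greatest one,
    \<open>m\<close>, is where \<open>y\<close> first leaves it going backwards; \<open>est\<close>
    assumes closeness only after \<open>m\<close>, so it applies at \<open>m\<close> and contradicts
    \<open>small\<close>.\<close>
  define C where "C = {t \<in> {t0..s}. 1 \<le> norm (y t - x t)}"
  have "C = {}"
  proof (rule ccontr)
    assume "C \<noteq> {}"
    have cont: "continuous_on {t0..s} (\<lambda>t. norm (y t - x t))"
      using s by (intro continuous_intros continuous_on_subset[OF solves_on_continuous[OF x]]
        continuous_on_subset[OF solves_on_continuous[OF y]]) auto
    have "closed C"
      unfolding C_def by (rule continuous_on_closed_Collect_le[OF continuous_on_const cont]) auto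
    then have "compact C"
      by (metis (lifting) C_def bounded_subset bounded_closed_interval compact_eq_bounded_closed
          mem_Collect_eq subsetI)
    then obtain m where m: "m \<in> C" "\<And>t. t \<in> C \<Longrightarrow> t \<le> m"
      using compact_attains_sup[OF _ \<open>C \<noteq> {}\<close>] by blast
    have "norm (y m - x m) \<le> norm (y s - x s) * exp (L * (T - t0))"
    proof (rule est)
      show "m \<in> {t0..s}" using m(1) by (simp add: C_def)
      show "norm (y t - x t) < 1" if "t \<in> {m<..<s}" for t
        using that m(1) m(2)[of t] by (force simp: C_def)
    qed
    then show False
      using m(1) small by (simp add: C_def)
  qed
  then have "norm (y t - x t) < 1" if "t \<in> {t0<..<s}" for t
    using that equals0D[of C t] by (auto simp: C_def not_le)
  then show ?thesis
    using s by (intro est) auto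
qed

section \<open>The map to the initial value and its continuity\<close>

text \<open>The choice below is meaningful only for \<open>s \<in> [t0,T]\<close>.\<close>

definition initial_value ::
  "(real^'n \<Rightarrow> real \<Rightarrow> real^'n) \<Rightarrow> real \<Rightarrow> real \<Rightarrow> real^'n \<Rightarrow> real \<Rightarrow> real^'n" where
  "initial_value f t0 T \<xi> s = (SOME x. solves_on f t0 T x \<and> x s = \<xi>) t0"

lemma obtain_initial_value_solution:
  assumes "uniquely_solvable f t0 T" "s \<in> {t0..T}"
  obtains x where "solves_on f t0 T x" "x s = \<xi>" "initial_value f t0 T \<xi> s = x t0"
proof -
  have "\<exists>x. solves_on f t0 T x \<and> x s = \<xi>"
    using assms unfolding uniquely_solvable_def by blast
  then have "solves_on f t0 T (SOME x. solves_on f t0 T x \<and> x s = \<xi>) \<and>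
      (SOME x. solves_on f t0 T x \<and> x s = \<xi>) s = \<xi>"
    by (rule someI_ex)
  then show thesis
    using that by (auto simp: initial_value_def)
qed

text \<open>Uniqueness makes the chosen solution irrelevant. Consequently the map is constant along
  every solution, which later gives \<open>W\<close> derivative 0.\<close>

lemma initial_value_eq:
  assumes "uniquely_solvable f t0 T" "solves_on f t0 T x" "s \<in> {t0..T}"
  shows "initial_value f t0 T (x s) s = x t0"
proof -
  obtain y where "solves_on f t0 T y" "y s = x s" "initial_value f t0 T (x s) s = y t0"
    using obtain_initial_value_solution[OF assms(1,3)] by metis
  then show ?thesis
    using solves_on_unique[OF assms(1), of y x s t0] assms by auto
qed

text \<open>The solution \<open>x\<close> through the limit point is fixed and every nearby solution
  is compared with it, so one ball and one Lipschitz constant serve for all of them.\<close>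

lemma continuous_on_initial_value:
  fixes f :: "real^'n \<Rightarrow> real \<Rightarrow> real^'n"
  assumes cont: "continuous_on (UNIV \<times> {t0..T}) (\<lambda>(x, t). f x t)"
    and lip: "local_lipschitz {t0..T} UNIV (\<lambda>t x. f x t)"
    and uniq: "uniquely_solvable f t0 T"
  shows "continuous_on (UNIV \<times> {t0..T}) (\<lambda>(\<xi>, s). initial_value f t0 T \<xi> s)"
  unfolding case_prod_beta' continuous_on_def
proof (safe, unfold fst_conv snd_conv)
  fix \<xi> :: "real^'n" and s assume s: "s \<in> {t0..T}"
  obtain x where x: "solves_on f t0 T x" "x s = \<xi>" and x0: "initial_value f t0 T \<xi> s = x t0"
    using obtain_initial_value_solution[OF uniq s] .
  note xc = solves_on_continuous[OF x(1)]
  obtain B where B: "\<And>t. t \<in> {t0..T} \<Longrightarrow> norm (x t) \<le> B"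
    using compact_imp_bounded[OF compact_continuous_image[OF xc compact_Icc]]
    unfolding bounded_iff by (metis imageI)
  \<comment> \<open>The extra 1 in the radius makes room for the tube around \<open>x\<close>.
    Continuity in \<open>t\<close> and compactness turn the local Lipschitz condition into a single
    constant.\<close>
  obtain L where L: "\<And>t. t \<in> {t0..T} \<Longrightarrow> L-lipschitz_on (cball 0 (B + 1)) (\<lambda>z. f z t)"
  proof (rule local_lipschitz_compact_implies_lipschitz)
    show "local_lipschitz {t0..T} (cball 0 (B + 1)) (\<lambda>t z. f z t)"
      using lip by (rule local_lipschitz_subset) auto
    show "continuous_on {t0..T} (\<lambda>t. f z t)" for z
      by (rule continuous_on_compose2[OF cont[unfolded case_prod_beta'],
            where f = "\<lambda>t. (z, t)", unfolded fst_conv snd_conv])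
        (auto intro!: continuous_on_Pair continuous_on_const continuous_on_id)
  qed auto
  let ?F = "at (\<xi>, s) within UNIV \<times> {t0..T}"
  \<comment> \<open>The distance is taken to \<open>x (snd p)\<close> and not to
    \<open>\<xi>\<close>: both solutions have to be compared at the same time.\<close>
  define e where "e p = norm (fst p - x (snd p)) * exp (L * (T - t0))" for p
  have in_dom: "\<forall>\<^sub>F p in ?F. snd p \<in> {t0..T}"
    unfolding eventually_at_filter by (rule always_eventually) auto
  have "continuous_on (UNIV \<times> {t0..T}) e"
    unfolding e_def
    by (intro continuous_intros continuous_on_compose2[OF xc]) auto
  then have "(e \<longlongrightarrow> e (\<xi>, s)) ?F"
    unfolding continuous_on_def by (rule bspec) (use s in simp)
  then have e0: "(e \<longlongrightarrow> 0) ?F"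
    using x(2) by (simp add: e_def)
  \<comment> \<open>Since \<open>e\<close> tends to 0, it is eventually below 1, which is the
    smallness that the estimate requires.\<close>
  have "\<forall>\<^sub>F p in ?F. norm (initial_value f t0 T (fst p) (snd p) - x t0) \<le> e p"
    using in_dom order_tendstoD(2)[OF e0 zero_less_one]
  proof eventually_elim
    case (elim p)
    obtain y where y: "solves_on f t0 T y" "y (snd p) = fst p"
      "initial_value f t0 T (fst p) (snd p) = y t0"
      using obtain_initial_value_solution[OF uniq elim(1)] .
    have "norm (y t0 - x t0) \<le> norm (y (snd p) - x (snd p)) * exp (L * (T - t0))"
      by (rule initial_value_estimate[OF x(1) y(1) L])
        (use B elim y(2) in \<open>auto simp: e_def\<close>)
    then show ?case
      by (simp add: y e_def)
  qed
  then have "((\<lambda>p. initial_value f t0 T (fst p) (snd p) - x t0) \<longlongrightarrow> 0) ?F"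
    by (rule Lim_null_comparison[OF _ e0])
  then show "((\<lambda>p. initial_value f t0 T (fst p) (snd p)) \<longlongrightarrow> initial_value f t0 T \<xi> s) ?F"
    unfolding x0 by (rule LIM_zero_cancel)
qed

section \<open>Stability and Lyapunov functions\<close>

theorem theorem4p1:
  fixes f :: "real^'n \<Rightarrow> real \<Rightarrow> real^'n"
    and t0 T :: real
    and \<Phi> :: "real \<Rightarrow> (real^'n) set"
    and G0 :: "(real^'n) set"
  assumes "t0 < T"
    and "continuous_on (UNIV \<times> {t0..T}) (\<lambda>(x, t). f x t)"
    and "local_lipschitz {t0..T} UNIV (\<lambda>t x. f x t)"
    and "uniquely_solvable f t0 T"
    and "\<And>t. t \<in> {t0..T} \<Longrightarrow> f 0 t = 0"
    and "\<And>t. t \<in> {t0..T} \<Longrightarrow> compact (\<Phi> t) \<and> 0 \<in> \<Phi> t"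
    and "G0 \<subseteq> \<Phi> t0" and "0 \<in> G0"
    and "starry G0" and "compact G0"
  shows "zero_stable f G0 \<Phi> t0 T \<longleftrightarrow>
    (\<exists>W :: real^'n \<Rightarrow> real \<Rightarrow> real^'n \<Rightarrow> real.
       continuous_on (UNIV \<times> {t0..T} \<times> UNIV) (\<lambda>(x, t, x0). W x t x0) \<and>
       (\<forall>x0 x. solves_on f t0 T x \<longrightarrow>
          (\<forall>t\<in>{t0..T}. \<exists>D\<le>0.
             ((\<lambda>s. W (x s) s x0) has_real_derivative D) (at t within {t0..T}))) \<and>
       (\<forall>t\<in>{t0..T}. {(x, x0). W x t x0 \<le> 1} \<subseteq> {(x, x0). x \<in> \<Phi> t \<and> x0 \<in> G0}) \<and>
       G0 \<subseteq> {x0. W x0 t0 x0 \<le> 1})"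
proof -
  let "_ \<longleftrightarrow> (\<exists>W. ?P W)" = ?thesis
  show ?thesis
  proof
    assume stable: "zero_stable f G0 \<Phi> t0 T"
    let ?\<pi> = "initial_value f t0 T"
    define W where "W x t x0 = 1 + infdist (?\<pi> x t) G0 + infdist x0 G0" for x t x0
    have G0: "infdist z G0 \<le> 0 \<longleftrightarrow> z \<in> G0" for z
      using in_closed_iff_infdist_zero[OF compact_imp_closed[OF \<open>compact G0\<close>], of z] \<open>0 \<in> G0\<close>
        infdist_nonneg[of z G0] by auto
    have W_le: "W x t x0 \<le> 1 \<longleftrightarrow> ?\<pi> x t \<in> G0 \<and> x0 \<in> G0" for x t x0
      using G0[of "?\<pi> x t"] G0[of x0] infdist_nonneg[of "?\<pi> x t" G0] infdist_nonneg[of x0 G0]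
      by (auto simp: W_def)
    show "\<exists>W. ?P W"
    proof (rule exI[where x = W], intro conjI allI impI ballI)
      have "continuous_on (UNIV \<times> {t0..T} \<times> UNIV) (\<lambda>p. ?\<pi> (fst p) (fst (snd p)))"
        by (rule continuous_on_compose2[OF continuous_on_initial_value[OF assms(2-4), unfolded case_prod_beta'],
              where f = "\<lambda>p. (fst p, fst (snd p))", unfolded fst_conv snd_conv])
          (auto intro!: continuous_on_Pair continuous_on_fst continuous_on_snd continuous_on_id)
      then show "continuous_on (UNIV \<times> {t0..T} \<times> UNIV) (\<lambda>(x, t, x0). W x t x0)"
        unfolding W_def case_prod_beta' by (intro continuous_intros)
    next
      fix x0 x t assume x: "solves_on f t0 T x" and t: "t \<in> {t0..T}"
      \<comment> \<open>\<open>W\<close> equals its value at \<open>t\<close> on the whole interval,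
        so any positive radius works for the transformation.\<close>
      have "((\<lambda>s. W (x s) s x0) has_real_derivative 0) (at t within {t0..T})"
        by (rule has_field_derivative_transform_within[OF DERIV_const[of "W (x t) t x0"] zero_less_one t])
          (use t in \<open>simp add: W_def initial_value_eq[OF assms(4) x]\<close>)
      then show "\<exists>D\<le>0. ((\<lambda>s. W (x s) s x0) has_real_derivative D) (at t within {t0..T})"
        by blast
    next
      fix t assume t: "t \<in> {t0..T}"
      \<comment> \<open>The solution through \<open>x\<close> at time \<open>t\<close> starts in
        \<open>G0\<close>, so stability applies to it.\<close>
      have "x \<in> \<Phi> t" if "?\<pi> x t \<in> G0" for x
      proof -
        obtain y where y: "solves_on f t0 T y" "y t = x" "?\<pi> x t = y t0"
          using obtain_initial_value_solution[OF assms(4) t] .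
        then show ?thesis
          using stable that t ode_solution_eq[OF assms(4) y(1) t] unfolding zero_stable_def by metis
      qed
      then show "{(x, x0). W x t x0 \<le> 1} \<subseteq> {(x, x0). x \<in> \<Phi> t \<and> x0 \<in> G0}"
        by (auto simp: W_le)
    next
      have t0: "t0 \<in> {t0..T}" using \<open>t0 < T\<close> by simp
      have "?\<pi> z t0 = z" for z
        using obtain_initial_value_solution[OF assms(4) t0, of z] by metis
      then show "G0 \<subseteq> {x0. W x0 t0 x0 \<le> 1}"
        by (auto simp: W_le)
    qed
  next
    assume "\<exists>W. ?P W"
    then obtain W where dW: "\<And>x0 x t. \<lbrakk>solves_on f t0 T x; t \<in> {t0..T}\<rbrakk> \<Longrightarrow> \<exists>D\<le>0.
          ((\<lambda>s. W (x s) s x0) has_real_derivative D) (at t within {t0..T})"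
      and sub: "\<And>t x x0. \<lbrakk>t \<in> {t0..T}; W x t x0 \<le> 1\<rbrakk> \<Longrightarrow> x \<in> \<Phi> t"
      and init: "\<And>x0. x0 \<in> G0 \<Longrightarrow> W x0 t0 x0 \<le> 1"
      by blast
    show "zero_stable f G0 \<Phi> t0 T"
      unfolding zero_stable_def
    proof (intro ballI)
      fix x0 t assume "x0 \<in> G0" and t: "t \<in> {t0..T}"
      have "t0 \<in> {t0..T}" using \<open>t0 < T\<close> by simp
      then obtain x where x: "solves_on f t0 T x" "x t0 = x0"
        using obtain_initial_value_solution[OF assms(4)] by metis
      \<comment> \<open>The parameter of \<open>W\<close> is frozen at the starting point of the
        solution, so that \<open>init\<close> bounds the value at \<open>t0\<close>.\<close>
      define w where "w s = W (x s) s x0" for s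
      have w': "\<exists>D\<le>0. (w has_real_derivative D) (at s within {t0..T})" if "s \<in> {t0..T}" for s
        unfolding w_def using dW[OF x(1) that] .
      have "w t \<le> w t0"
      proof (rule DERIV_nonpos_imp_decreasing_open[where f = w])
        show "t0 \<le> t" using t by simp
        fix s assume "t0 < s" "s < t"
        then have "at s within {t0..T} = at s" "s \<in> {t0..T}"
          using t by (auto intro!: at_within_interior)
        then show "\<exists>D. (w has_real_derivative D) (at s) \<and> D \<le> 0"
          using w'[of s] by auto
      next
        \<comment> \<open>The sign of the derivative was used only at interior times; continuity
          extends the monotonicity to the endpoints.\<close>
        have "continuous_on {t0..T} w"
          using w' by (meson DERIV_continuous continuous_on_eq_continuous_within)
        then show "continuous_on {t0..t} w"
          by (rule continuous_on_subset) (use t in auto)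
      qed
      then have "W (x t) t x0 \<le> 1"
        using init[OF \<open>x0 \<in> G0\<close>] x(2) by (simp add: w_def)
      then show "ode_solution f t0 T t x0 \<in> \<Phi> t"
        using sub[OF t] ode_solution_eq[OF assms(4) x(1) t] x(2) by simp
    qed
  qed
qed

end
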